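(* Let $S\equiv(S,\cdot,I,\lambda,\rho)$ be a partial semigroup, let $i,j\in I$, let $a\in S_{ji}$ be sandwich-regular, and let $b\in V(a)$. Let $r=|\widehat{H}_b^a/\mathscr R^a|$ and $l=|\widehat{H}_b^a/\mathscr L^a|$. Then $$\operatorname{rank}(\mathbb E_a(P^a))\geq\operatorname{rank}(\mathbb E_b(W))+\max(r,l)-1$$ and $$\operatorname{idrank}(\mathbb E_a(P^a))\geq\operatorname{idrank}(\mathbb E_b(W))+\max(r,l)-1,$$ with equality in both if $P^a$ is MI-dominated.
   Context: A partial semigroup is a 5-tuple $(S,\cdot,I,\lambda,\rho)$ consisting of a class $S$, a partial binary operation $(x,y)\mapsto x\cdot y=xy$, a class $I$, and functions $\lambda,\rho:S\to I$ such that for all $x,y,z\in S$: (1) $xy$ is defined iff $x\rho=y\lambda$; (2) if $xy$ is defined then $(xy)\lambda=x\lambda$ and $(xy)\rho=y\rho$; (3) if $xy$ and $yz$ are defined then $(xy)z=x(yz)$; (4) for all $i,j\in I$, $S_{ij}=\{x\in S: x\lambda=i,\ x\rho=j\}$ is a set. For $x\in S$, $V(x)=\{y\in S: x=xyx,\ y=yxy\}$. $\operatorname{Reg}(S)=\{x\in S: x=xyx \text{ for some } y\in S\}$; likewise for semigroups. For $a\in S_{ji}$, the sandwich semigroup is $S_{ij}^a=(S_{ij},\star_a)$, where $x\star_a y=xay$. A regular element $a\in S_{ji}$ is sandwich-regular if $aS_{ij}a\subseteq\operatorname{Reg}(S)$. Assume $a$ is sandwich-regular and $b\in V(a)$ (so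 $b\in S_{ij}$). Write $P^a=\operatorname{Reg}(S_{ij}^a)$, which is a regular subsemigroup of $S_{ij}^a$ (containing $b$), and $W=(aS_{ij}a,\circledast)$, where $u\circledast v=ubv$, i.e. $axa\circledast aya=axaya$; $W$ is a regular monoid with identity $a$ and underlying set $aP^aa$. $\mathbb E_a(P^a)$ is the subsemigroup of $P^a$ generated by all idempotents $\{x\in P^a:x=xax\}$ of $P^a$, and $\mathbb E_b(W)$ is the subsemigroup of $W$ generated by all idempotents $\{y\in W:y=yby\}$ of $W$. $\mathscr R^a,\mathscr L^a$ are Green's relations of $S_{ij}^a$ (which on $P^a$ coincide with those of $P^a$). $\widehat{H}_b^a=\{y\in P^a: aya \text{ and } aba=a \text{ are } \mathscr H\text{-related in } W\}$, and $\widehat{H}_b^a/\mathscr R^a$, $\widehat{H}_b^a/\mathscr L^a$ are the quotients of this set by the restrictions of $\mathscr R^a,\mathscr L^a$. For a semigroup $T$, $\langle A\rangle$ is the subsemigroup generated by $A$, $\operatorname{rank}(T)=\min\{|A|:A\subseteq T,\ \langle A\rangle=T\}$, and if $T$ is idempotent-generated, $\operatorname{idrank}(T)=\min\{|A|:A\subseteq E(T),\ \langle A\rangle=T\}$, where $E(T)$ is the set of idempotents of $T$. These are cardinals, possibly infinite ($\kappa-1=\kappa$ for infinite $\kappa$). In a regular semigroup $T$: $u\in T$ is a mid-identity if $xuy=xy$ for all $x,y\in T$; the natural partial order is $x\preceq y$ iff $x=ey=yf$ for some idempotents $e,f\in T$; $T$ is MI-dominated if every idempotent of $T$ is $\preceq$-below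 some mid-identity of $T$. *)

theory Defs
  imports Main
begin

unbundle cardinal_syntax

section \<open>Partial semigroups\<close>

text \<open>The partial operation is option-valued: a product is defined iff it is not \<^term>\<open>None\<close>.
  Only its behaviour on the carrier is constrained.\<close>

record ('s, 'i) partial_sg =
  elts :: "'s set"
  pmult :: "'s \<Rightarrow> 's \<Rightarrow> 's option"
  objs :: "'i set"
  lam :: "'s \<Rightarrow> 'i"
  rho :: "'s \<Rightarrow> 'i"

text \<open>The usual requirement that every hom-class is a set holds automatically here,
  because \<^term>\<open>elts S\<close> is itself a set.\<close>

locale partial_semigroup =
  fixes S :: "('s, 'i) partial_sg"
  assumes lam_in: "x \<in> elts S \<Longrightarrow> lam S x \<in> objs S"
    and rho_in: "x \<in> elts S \<Longrightarrow> rho S x \<in> objs S"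
    and pmult_in: "\<lbrakk>x \<in> elts S; y \<in> elts S; pmult S x y = Some z\<rbrakk> \<Longrightarrow> z \<in> elts S"
    and pmult_defined: "\<lbrakk>x \<in> elts S; y \<in> elts S\<rbrakk> \<Longrightarrow> pmult S x y \<noteq> None \<longleftrightarrow> rho S x = lam S y"
    and lam_pmult: "\<lbrakk>x \<in> elts S; y \<in> elts S; pmult S x y = Some z\<rbrakk> \<Longrightarrow> lam S z = lam S x"
    and rho_pmult: "\<lbrakk>x \<in> elts S; y \<in> elts S; pmult S x y = Some z\<rbrakk> \<Longrightarrow> rho S z = rho S y"
    and pmult_assoc: "\<lbrakk>x \<in> elts S; y \<in> elts S; z \<in> elts S; pmult S x y = Some u; pmult S y z = Some v\<rbrakk>
      \<Longrightarrow> pmult S u z = pmult S x v"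

definition hom_set :: "('s, 'i) partial_sg \<Rightarrow> 'i \<Rightarrow> 'i \<Rightarrow> 's set" where
  "hom_set S i j = {x \<in> elts S. lam S x = i \<and> rho S x = j}"

definition pmult3 :: "('s, 'i) partial_sg \<Rightarrow> 's \<Rightarrow> 's \<Rightarrow> 's \<Rightarrow> 's option" where
  "pmult3 S x y z = Option.bind (pmult S x y) (\<lambda>w. pmult S w z)"

text \<open>The value of the product \<open>xyz\<close>, meaningful only when that product is defined.\<close>

definition prod3 :: "('s, 'i) partial_sg \<Rightarrow> 's \<Rightarrow> 's \<Rightarrow> 's \<Rightarrow> 's" where
  "prod3 S x y z = the (pmult3 S x y z)"

definition pinverses :: "('s, 'i) partial_sg \<Rightarrow> 's \<Rightarrow> 's set" where
  "pinverses S x = {y \<in> elts S. pmult3 S x y x = Some x \<and> pmult3 S y x y = Some y}"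

definition preg :: "('s, 'i) partial_sg \<Rightarrow> 's set" where
  "preg S = {x \<in> elts S. \<exists>y \<in> elts S. pmult3 S x y x = Some x}"

definition sandwich_regular :: "('s, 'i) partial_sg \<Rightarrow> 'i \<Rightarrow> 'i \<Rightarrow> 's \<Rightarrow> bool" where
  "sandwich_regular S i j a \<longleftrightarrow>
     a \<in> hom_set S j i \<and> a \<in> preg S \<and> (\<lambda>x. prod3 S a x a) ` hom_set S i j \<subseteq> preg S"


section \<open>Semigroups\<close>

record 'a sgrp =
  scarrier :: "'a set"
  sop :: "'a \<Rightarrow> 'a \<Rightarrow> 'a"

definition sg_idems :: "'a sgrp \<Rightarrow> 'a set" where
  "sg_idems T = {x \<in> scarrier T. x = sop T x x}"

definition sg_reg :: "'a sgrp \<Rightarrow> 'a set" where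
  "sg_reg T = {x \<in> scarrier T. \<exists>y \<in> scarrier T. x = sop T (sop T x y) x}"

inductive_set sg_gen :: "'a sgrp \<Rightarrow> 'a set \<Rightarrow> 'a set" for T :: "'a sgrp" and A :: "'a set" where
  base: "x \<in> A \<Longrightarrow> x \<in> sg_gen T A"
| mult: "x \<in> sg_gen T A \<Longrightarrow> y \<in> sg_gen T A \<Longrightarrow> sop T x y \<in> sg_gen T A"

definition idem_gen :: "'a sgrp \<Rightarrow> 'a sgrp" where
  "idem_gen T = T\<lparr>scarrier := sg_gen T (sg_idems T)\<rparr>"

text \<open>Green's relations: \<open>x\<close> and \<open>y\<close> are \<open>\<R>\<close>-related iff \<open>xT\<^sup>1 = yT\<^sup>1\<close>, dually for \<open>\<L>\<close>.\<close>

definition green_R :: "'a sgrp \<Rightarrow> 'a rel" where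
  "green_R T = {(x, y). x \<in> scarrier T \<and> y \<in> scarrier T \<and>
     insert x (sop T x ` scarrier T) = insert y (sop T y ` scarrier T)}"

definition green_L :: "'a sgrp \<Rightarrow> 'a rel" where
  "green_L T = {(x, y). x \<in> scarrier T \<and> y \<in> scarrier T \<and>
     insert x ((\<lambda>t. sop T t x) ` scarrier T) = insert y ((\<lambda>t. sop T t y) ` scarrier T)}"

definition green_H :: "'a sgrp \<Rightarrow> 'a rel" where
  "green_H T = green_R T \<inter> green_L T"

definition mid_identity :: "'a sgrp \<Rightarrow> 'a \<Rightarrow> bool" where
  "mid_identity T u \<longleftrightarrow> u \<in> scarrier T \<and>
     (\<forall>x \<in> scarrier T. \<forall>y \<in> scarrier T. sop T (sop T x u) y = sop T x y)"

definition natural_le :: "'a sgrp \<Rightarrow> 'a \<Rightarrow> 'a \<Rightarrow> bool" where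
  "natural_le T x y \<longleftrightarrow> (\<exists>e \<in> sg_idems T. \<exists>f \<in> sg_idems T. x = sop T e y \<and> x = sop T y f)"

definition MI_dominated :: "'a sgrp \<Rightarrow> bool" where
  "MI_dominated T \<longleftrightarrow> (\<forall>e \<in> sg_idems T. \<exists>u. mid_identity T u \<and> natural_le T e u)"


section \<open>Cardinals and ranks\<close>

text \<open>Cardinals are the cardinal orders of the library, compared by \<open>\<le>o\<close> and \<open>=o\<close>
  across types. The operations below are determined up to \<open>=o\<close>.\<close>

definition min_card :: "'a set set \<Rightarrow> 'a rel" where
  "min_card \<A> = |SOME A. A \<in> \<A> \<and> (\<forall>B \<in> \<A>. |A| \<le>o |B| )|"

lemma min_card_attained_and_least:
  assumes "\<A> \<noteq> {}"
  shows "\<exists>A \<in> \<A>. min_card \<A> = |A|" and "\<forall>B \<in> \<A>. min_card \<A> \<le>o |B|"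
proof -
  have "\<exists>r \<in> card_of ` \<A>. \<forall>r' \<in> card_of ` \<A>. r \<le>o r'"
    by (rule exists_minim_Card_order) (use assms card_of_Card_order in auto)
  then have "\<exists>A. A \<in> \<A> \<and> (\<forall>B \<in> \<A>. |A| \<le>o |B| )"
    by blast
  from someI_ex[OF this]
  show "\<exists>A \<in> \<A>. min_card \<A> = |A|" and "\<forall>B \<in> \<A>. min_card \<A> \<le>o |B|"
    unfolding min_card_def by blast+
qed

definition sg_rank :: "'a sgrp \<Rightarrow> 'a rel" where
  "sg_rank T = min_card {A. A \<subseteq> scarrier T \<and> sg_gen T A = scarrier T}"

text \<open>Meaningful for idempotent-generated semigroups.\<close>

definition sg_idrank :: "'a sgrp \<Rightarrow> 'a rel" where
  "sg_idrank T = min_card {A. A \<subseteq> sg_idems T \<and> sg_gen T A = scarrier T}"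

definition cmax :: "'a rel \<Rightarrow> 'a rel \<Rightarrow> 'a rel" where
  "cmax r s = (if r \<le>o s then s else r)"

text \<open>The cardinal \<open>\<kappa> - 1\<close>: remove one point from a set of size \<open>\<kappa>\<close>.\<close>

definition cpred :: "'a rel \<Rightarrow> 'a rel" where
  "cpred r = |Field r - {SOME x. x \<in> Field r}|"

lemma cpred_finite: "card (Field (cpred r)) = card (Field r) - 1"
proof (cases "Field r = {}")
  case False
  then have "(SOME x. x \<in> Field r) \<in> Field r"
    by (simp add: some_in_eq)
  then show ?thesis
    by (simp add: cpred_def Field_card_of card_Diff_singleton)
qed (simp add: cpred_def Field_card_of)

lemma cpred_infinite:
  assumes "infinite (Field r)" and "Card_order r"
  shows "cpred r =o r"
proof -
  obtain h where "bij_betw h (Field r) (Field r - {SOME x. x \<in> Field r})"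
    using infinite_imp_bij_betw[OF assms(1)] by blast
  then have "|Field r| =o cpred r"
    unfolding cpred_def by (metis card_of_ordIsoI)
  then show ?thesis
    using card_of_Field_ordIso[OF assms(2)] ordIso_symmetric ordIso_transitive by blast
qed


section \<open>Sandwich semigroups\<close>

text \<open>\<open>S\<^sub>i\<^sub>j\<^sup>a\<close>, with \<open>x \<star>\<^sub>a y = xay\<close>, for \<open>a \<in> S\<^sub>j\<^sub>i\<close>.\<close>

definition sandwich_sg :: "('s, 'i) partial_sg \<Rightarrow> 'i \<Rightarrow> 'i \<Rightarrow> 's \<Rightarrow> 's sgrp" where
  "sandwich_sg S i j a = \<lparr>scarrier = hom_set S i j, sop = (\<lambda>x y. prod3 S x a y)\<rparr>"

text \<open>\<open>P\<^sup>a = Reg(S\<^sub>i\<^sub>j\<^sup>a)\<close>, with the operation of \<open>S\<^sub>i\<^sub>j\<^sup>a\<close>.\<close>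

definition P_sg :: "('s, 'i) partial_sg \<Rightarrow> 'i \<Rightarrow> 'i \<Rightarrow> 's \<Rightarrow> 's sgrp" where
  "P_sg S i j a = (sandwich_sg S i j a)\<lparr>scarrier := sg_reg (sandwich_sg S i j a)\<rparr>"

text \<open>\<open>W = aS\<^sub>i\<^sub>ja\<close>, with \<open>u \<circledast> v = ubv\<close>.\<close>

definition W_sg :: "('s, 'i) partial_sg \<Rightarrow> 'i \<Rightarrow> 'i \<Rightarrow> 's \<Rightarrow> 's \<Rightarrow> 's sgrp" where
  "W_sg S i j a b =
     \<lparr>scarrier = (\<lambda>x. prod3 S a x a) ` hom_set S i j, sop = (\<lambda>u v. prod3 S u b v)\<rparr>"

definition H_hat :: "('s, 'i) partial_sg \<Rightarrow> 'i \<Rightarrow> 'i \<Rightarrow> 's \<Rightarrow> 's \<Rightarrow> 's set" where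
  "H_hat S i j a b =
     {y \<in> scarrier (P_sg S i j a). (prod3 S a y a, prod3 S a b a) \<in> green_H (W_sg S i j a b)}"

end

theory Submission
  imports Defs
begin

text \<open>
  The element \<open>b\<close> is an idempotent mid-identity of the regular semigroup \<open>P = P\<^sup>a\<close>, and
  \<open>W\<close> is a copy of the local monoid \<open>b \<star> P \<star> b\<close>, so that \<open>x \<mapsto> axa\<close> is a retraction of \<open>P\<close>
  onto it. The preimage \<open>U\<close> of the identity is a rectangular band of \<open>r\<close> rows and \<open>l\<close> columns.
  A product of elements of \<open>\<E>(P)\<close> lies in \<open>U\<close> only if all the factors do, so a generating set
  of \<open>\<E>(P)\<close> contains a generating set of \<open>U\<close>, which has at least \<open>max(r, l)\<close> elements, and the
  rest of it maps onto a generating set of \<open>\<E>(W)\<close> with the identity removed. Conversely, if every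
  idempotent \<open>e\<close> lies below some \<open>u \<in> U\<close>, then \<open>e = u(beb)u\<close>, so a generating set of the
  copy of \<open>\<E>(W)\<close> together with one of \<open>U\<close> generates \<open>\<E>(P)\<close>.
\<close>

section \<open>Cardinals\<close>

lemma finite_ordLeq_iff_card:
  "finite A \<Longrightarrow> finite B \<Longrightarrow> |A| \<le>o |B| \<longleftrightarrow> card A \<le> card B"
  using card_of_ordLeq[of A B] inj_on_iff_card_le[of A B] by metis

text \<open>On finite sets this is monotonicity of subtracting 1; an infinite set keeps its
  cardinality when a point is removed.\<close>

lemma ordLeq_diff_singleton:
  assumes "|A| \<le>o |B|" "x \<in> A" "y \<in> B"
  shows "|A - {x}| \<le>o |B - {y}|"
proof (cases "finite B")
  case True
  moreover have "finite A"
    using assms(1) True by (rule card_of_ordLeq_finite)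
  ultimately show ?thesis
    using assms by (simp add: finite_ordLeq_iff_card diff_le_mono)
next
  case False
  then obtain h where "bij_betw h B (B - {y})"
    using infinite_imp_bij_betw[OF False] by blast
  then have "|B| =o |B - {y}|"
    by (rule card_of_ordIsoI)
  moreover have "|A - {x}| \<le>o |A|"
    by (rule card_of_mono1) simp
  ultimately show ?thesis
    using assms(1) ordLeq_transitive ordLeq_ordIso_trans by metis
qed

text \<open>\<open>cpred\<close> removes a point chosen by \<open>SOME\<close> from the field of
  \<open>r\<close>. This frees the computation from that choice: any representing set and any of its
  points will do.\<close>

lemma cpred_ordIso_diff_singleton:
  assumes "r =o |A|" "x \<in> A"
  shows "cpred r =o |A - {x}|"
proof -
  have "|Field r| =o r"
    using card_of_Field_ordIso Card_order_ordIso[OF card_of_Card_order assms(1)] .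
  then have iso: "|Field r| =o |A|"
    using assms(1) by (rule ordIso_transitive)
  then obtain f where "bij_betw f (Field r) A"
    using card_of_ordIso[THEN iffD2] by blast
  then have "Field r \<noteq> {}"
    using assms(2) by (auto simp: bij_betw_def)
  then have some: "(SOME x. x \<in> Field r) \<in> Field r"
    by (simp add: some_in_eq)
  have "|Field r| \<le>o |A|" "|A| \<le>o |Field r|"
    using iso by (simp_all add: ordIso_iff_ordLeq)
  then show ?thesis
    unfolding cpred_def ordIso_iff_ordLeq
    using ordLeq_diff_singleton[OF _ some assms(2)] ordLeq_diff_singleton[OF _ assms(2) some]
    by simp
qed

text \<open>The removed point may be taken from the left summand. In the rank bounds it is the
  identity of \<open>W\<close>, which lies in every generating set there.\<close>

lemma cpred_csum:
  assumes "Card_order m" "x \<in> A"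
  shows "cpred ( |A| +c m) =o |A - {x}| +c m"
proof -
  have "|A| +c m =o |A <+> Field m|"
    by (simp add: csum_def Field_card_of card_of_refl)
  then have "cpred ( |A| +c m) =o |(A <+> Field m) - {Inl x}|"
    by (rule cpred_ordIso_diff_singleton) (use assms(2) in auto)
  also have "(A <+> Field m) - {Inl x} = (A - {x}) <+> Field m"
    by auto
  also have "|(A - {x}) <+> Field m| =o |A - {x}| +c m"
    by (simp add: csum_def Field_card_of card_of_refl)
  finally show ?thesis .
qed

lemma csum_Diff_Int: "|A - U| +c |A \<inter> U| \<le>o |A|"
  unfolding csum_def Field_card_of
  by (rule card_of_ordLeqI[of "case_sum id id"]) (auto simp: inj_on_def)

lemma cmax_upper:
  assumes "Card_order r" "Card_order s"
  shows "r \<le>o cmax r s" "s \<le>o cmax r s"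
  using assms ordLeq_total[of r s] by (auto simp: cmax_def card_order_on_def ordLeq_reflexive)

lemma Card_order_cmax: "Card_order r \<Longrightarrow> Card_order s \<Longrightarrow> Card_order (cmax r s)"
  by (simp add: cmax_def)

lemma cmax_least: "r \<le>o k \<Longrightarrow> s \<le>o k \<Longrightarrow> cmax r s \<le>o k"
  by (simp add: cmax_def)


section \<open>Generated subsemigroups and opposite semigroups\<close>

lemma sg_gen_subset:
  assumes "A \<subseteq> scarrier T"
    and "\<And>x y. x \<in> scarrier T \<Longrightarrow> y \<in> scarrier T \<Longrightarrow> sop T x y \<in> scarrier T"
  shows "sg_gen T A \<subseteq> scarrier T"
proof
  show "x \<in> scarrier T" if "x \<in> sg_gen T A" for x
    using that by induction (use assms in auto)
qed

lemma sg_gen_superset: "A \<subseteq> sg_gen T A"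
  by (auto intro: sg_gen.base)

lemma sg_gen_least:
  assumes "A \<subseteq> sg_gen T B"
  shows "sg_gen T A \<subseteq> sg_gen T B"
proof
  show "x \<in> sg_gen T B" if "x \<in> sg_gen T A" for x
    using that by induction (use assms sg_gen.mult in auto)
qed

lemma sg_gen_mono:
  assumes "A \<subseteq> B"
  shows "sg_gen T A \<subseteq> sg_gen T B"
proof (rule sg_gen_least, rule subsetI)
  show "x \<in> sg_gen T B" if "x \<in> A" for x
    using assms that by (intro sg_gen.base) auto
qed

text \<open>The homomorphism law is asked for on \<open>D\<close> alone, since the operations are
  controlled only on carriers.\<close>

lemma image_sg_gen:
  assumes "sg_gen T A \<subseteq> D"
    and hom: "\<And>x y. x \<in> D \<Longrightarrow> y \<in> D \<Longrightarrow> f (sop T x y) = sop T' (f x) (f y)"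
  shows "f ` sg_gen T A = sg_gen T' (f ` A)"
proof
  have "f x \<in> sg_gen T' (f ` A)" if "x \<in> sg_gen T A" for x
    using that
  proof induction
    case (mult x y)
    then show ?case
      using assms sg_gen.mult by (metis subsetD)
  qed (auto intro: sg_gen.base)
  then show "f ` sg_gen T A \<subseteq> sg_gen T' (f ` A)"
    by auto
  show "sg_gen T' (f ` A) \<subseteq> f ` sg_gen T A"
  proof
    fix y
    assume "y \<in> sg_gen T' (f ` A)"
    then show "y \<in> f ` sg_gen T A"
    proof induction
      case (mult x y)
      then obtain u v where uv: "u \<in> sg_gen T A" "v \<in> sg_gen T A" "x = f u" "y = f v"
        by auto
      then have "sop T' x y = f (sop T u v)"
        using assms by (metis subsetD)
      moreover have "sop T u v \<in> sg_gen T A"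
        using uv(1,2) by (rule sg_gen.mult)
      ultimately show ?case
        by simp
    qed (auto intro: sg_gen.base)
  qed
qed

lemma sg_gen_cong_sop:
  assumes "sop T = sop T'"
  shows "sg_gen T A = sg_gen T' A"
proof -
  have "id ` sg_gen T A = sg_gen T' (id ` A)"
    by (rule image_sg_gen[of _ _ UNIV]) (simp_all add: assms)
  then show ?thesis
    by simp
qed

lemma scarrier_idem_gen: "scarrier (idem_gen T) = sg_gen T (sg_idems T)"
  by (simp add: idem_gen_def)

lemma sg_gen_idem_gen: "sg_gen (idem_gen T) A = sg_gen T A"
  by (rule sg_gen_cong_sop) (simp add: idem_gen_def)

text \<open>Passing to the opposite semigroup turns each fact about \<R> and rows into its dual
  about \<L> and columns.\<close>

definition op_sgrp :: "'a sgrp \<Rightarrow> 'a sgrp" where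
  "op_sgrp T = T\<lparr>sop := (\<lambda>x y. sop T y x)\<rparr>"

lemma op_sgrp_simps [simp]:
  "scarrier (op_sgrp T) = scarrier T"
  "sop (op_sgrp T) x y = sop T y x"
  by (simp_all add: op_sgrp_def)

lemma green_op_sgrp:
  "green_R (op_sgrp T) = green_L T" "green_L (op_sgrp T) = green_R T"
  by (simp_all add: green_R_def green_L_def)

lemma green_H_op_sgrp: "green_H (op_sgrp T) = green_H T"
  by (simp add: green_H_def green_op_sgrp Int_commute)

lemma sg_gen_op_sgrp: "sg_gen (op_sgrp T) A = sg_gen T A"
proof -
  have "x \<in> sg_gen T A" if "x \<in> sg_gen (op_sgrp T) A" for x
    using that by induction (auto intro: sg_gen.intros)
  moreover have "x \<in> sg_gen (op_sgrp T) A" if "x \<in> sg_gen T A" for x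
    using that
  proof induction
    case (mult x y)
    then show ?case
      using sg_gen.mult[of y "op_sgrp T" A x] by simp
  qed (auto intro: sg_gen.base)
  ultimately show ?thesis
    by blast
qed

lemma sg_idems_op_sgrp: "sg_idems (op_sgrp T) = sg_idems T"
  by (simp add: sg_idems_def)

lemma green_R_iff:
  assumes "\<And>x y. x \<in> scarrier T \<Longrightarrow> y \<in> scarrier T \<Longrightarrow> sop T x y \<in> scarrier T"
    and "\<And>x y z. x \<in> scarrier T \<Longrightarrow> y \<in> scarrier T \<Longrightarrow> z \<in> scarrier T
      \<Longrightarrow> sop T (sop T x y) z = sop T x (sop T y z)"
  shows "(x, y) \<in> green_R T \<longleftrightarrow> x \<in> scarrier T \<and> y \<in> scarrier T \<and>
     (x = y \<or> (\<exists>t \<in> scarrier T. x = sop T y t) \<and> (\<exists>t \<in> scarrier T. y = sop T x t))"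
    (is "_ \<longleftrightarrow> ?rhs")
proof
  have le: "insert u (sop T u ` scarrier T) \<subseteq> insert v (sop T v ` scarrier T)"
    if "u \<in> scarrier T" "v \<in> scarrier T" "t \<in> scarrier T" "u = sop T v t" for u v t
    using that assms by auto
  show "(x, y) \<in> green_R T" if ?rhs
    using that le[of x y] le[of y x] unfolding green_R_def by blast
qed (auto simp: green_R_def)


text \<open>If \<open>u = vt\<close> with \<open>t\<close> in the large semigroup and
  \<open>v = vzv\<close> with \<open>z\<close> in \<open>P\<close>, then
  \<open>vzu = vzvt = vt = u\<close>, so the multiplier \<open>t\<close> can be exchanged for
  \<open>zu\<close>, which lies in \<open>P\<close>.\<close>

lemma Restr_green_R_regular:
  assumes closed: "\<And>x y. x \<in> scarrier T \<Longrightarrow> y \<in> scarrier T \<Longrightarrow> sop T x y \<in> scarrier T"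
    and assoc: "\<And>x y z. x \<in> scarrier T \<Longrightarrow> y \<in> scarrier T \<Longrightarrow> z \<in> scarrier T
      \<Longrightarrow> sop T (sop T x y) z = sop T x (sop T y z)"
    and sub: "scarrier P \<subseteq> scarrier T" and op: "sop P = sop T"
    and P_closed: "\<And>x y. x \<in> scarrier P \<Longrightarrow> y \<in> scarrier P \<Longrightarrow> sop P x y \<in> scarrier P"
    and regular: "\<And>x. x \<in> scarrier P \<Longrightarrow> \<exists>y \<in> scarrier P. x = sop P x (sop P y x)"
    and H: "H \<subseteq> scarrier P"
  shows "Restr (green_R T) H = Restr (green_R P) H"
proof -
  have "(x, y) \<in> green_R T \<longleftrightarrow> (x, y) \<in> green_R P"
    if xy: "x \<in> scarrier P" "y \<in> scarrier P" for x y
  proof -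
    have *: "(\<exists>t \<in> scarrier T. u = sop T v t) \<longleftrightarrow> (\<exists>t \<in> scarrier P. u = sop T v t)"
      if uv: "u \<in> scarrier P" "v \<in> scarrier P" for u v
    proof
      assume "\<exists>t \<in> scarrier T. u = sop T v t"
      then obtain t where t: "t \<in> scarrier T" "u = sop T v t"
        by blast
      obtain z where z: "z \<in> scarrier P" "v = sop T v (sop T z v)"
        using regular uv op by metis
      have in_T: "u \<in> scarrier T" "v \<in> scarrier T" "z \<in> scarrier T"
        using uv z sub by auto
      have "sop T v (sop T z u) = sop T (sop T v (sop T z v)) t"
        using in_T t closed assoc by simp
      then have "u = sop T v (sop T z u)"
        using z(2) t(2) by simp
      moreover have "sop T z u \<in> scarrier P"
        using P_closed[of z u] z(1) uv by (simp add: op)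
      ultimately show "\<exists>t \<in> scarrier P. u = sop T v t"
        by blast
    qed (use sub in blast)
    have "(x, y) \<in> green_R T \<longleftrightarrow>
        x = y \<or> (\<exists>t \<in> scarrier T. x = sop T y t) \<and> (\<exists>t \<in> scarrier T. y = sop T x t)"
      using xy sub by (subst green_R_iff[OF closed assoc]) auto
    also have "\<dots> \<longleftrightarrow>
        x = y \<or> (\<exists>t \<in> scarrier P. x = sop P y t) \<and> (\<exists>t \<in> scarrier P. y = sop P x t)"
      unfolding op using *[of x y] *[of y x] xy by simp
    also have "\<dots> \<longleftrightarrow> (x, y) \<in> green_R P"
    proof (subst green_R_iff)
      show "sop P (sop P u v) w = sop P u (sop P v w)"
        if "u \<in> scarrier P" "v \<in> scarrier P" "w \<in> scarrier P" for u v w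
        using that sub assoc unfolding op by blast
    qed (use P_closed xy in auto)
    finally show ?thesis .
  qed
  then show ?thesis
    using H by blast
qed

lemma Restr_green_L_regular:
  assumes "\<And>x y. x \<in> scarrier T \<Longrightarrow> y \<in> scarrier T \<Longrightarrow> sop T x y \<in> scarrier T"
    and assoc: "\<And>x y z. x \<in> scarrier T \<Longrightarrow> y \<in> scarrier T \<Longrightarrow> z \<in> scarrier T
      \<Longrightarrow> sop T (sop T x y) z = sop T x (sop T y z)"
    and sub: "scarrier P \<subseteq> scarrier T" and op: "sop P = sop T"
    and "\<And>x y. x \<in> scarrier P \<Longrightarrow> y \<in> scarrier P \<Longrightarrow> sop P x y \<in> scarrier P"
    and regular: "\<And>x. x \<in> scarrier P \<Longrightarrow> \<exists>y \<in> scarrier P. x = sop P x (sop P y x)"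
    and "H \<subseteq> scarrier P"
  shows "Restr (green_L T) H = Restr (green_L P) H"
proof -
  have "\<exists>y \<in> scarrier P. x = sop P (sop P x y) x" if "x \<in> scarrier P" for x
    using regular[OF that] that sub assoc unfolding op by (metis subsetD)
  then have "Restr (green_R (op_sgrp T)) H = Restr (green_R (op_sgrp P)) H"
    by (intro Restr_green_R_regular) (use assms in \<open>auto simp: op_sgrp_def\<close>)
  then show ?thesis
    by (simp only: green_op_sgrp)
qed


section \<open>Regular semigroups with a mid-identity\<close>

text \<open>An axiomatization that is symmetric under reversing both products. In the application
  \<phi> is \<open>x \<mapsto> axa\<close> and \<psi> is \<open>w \<mapsto> bwb\<close>; the
  composite of \<phi> followed by \<psi> is the retraction onto the local monoid at
  \<open>b\<close>.\<close>

locale mid_identity_retract =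
  fixes P :: "'a sgrp" and W :: "'b sgrp" and b :: 'a
    and \<phi> :: "'a \<Rightarrow> 'b" and \<psi> :: "'b \<Rightarrow> 'a"
  assumes closed [simp]:
      "x \<in> scarrier P \<Longrightarrow> y \<in> scarrier P \<Longrightarrow> sop P x y \<in> scarrier P"
    and assoc [simp]: "x \<in> scarrier P \<Longrightarrow> y \<in> scarrier P \<Longrightarrow> z \<in> scarrier P
      \<Longrightarrow> sop P (sop P x y) z = sop P x (sop P y z)"
    and regular: "x \<in> scarrier P \<Longrightarrow> \<exists>y \<in> scarrier P. x = sop P x (sop P y x)"
    and mid_identity_b: "mid_identity P b"
    and \<phi>_in [simp]: "x \<in> scarrier P \<Longrightarrow> \<phi> x \<in> scarrier W"
    and \<psi>_in [simp]: "w \<in> scarrier W \<Longrightarrow> \<psi> w \<in> scarrier P"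
    and \<phi>_mult: "x \<in> scarrier P \<Longrightarrow> y \<in> scarrier P \<Longrightarrow> \<phi> (sop P x y) = sop W (\<phi> x) (\<phi> y)"
    and \<phi>_\<psi> [simp]: "w \<in> scarrier W \<Longrightarrow> \<phi> (\<psi> w) = w"
    and \<psi>_\<phi> [simp]: "x \<in> scarrier P \<Longrightarrow> \<psi> (\<phi> x) = sop P b (sop P x b)"
begin

abbreviation mul (infixr "\<cdot>" 70) where "x \<cdot> y \<equiv> sop P x y"
abbreviation "PC \<equiv> scarrier P"
abbreviation "EP \<equiv> sg_gen P (sg_idems P)"
abbreviation "EW \<equiv> sg_gen W (sg_idems W)"

section \<open>Transport of structure between \<open>P\<close> and \<open>W\<close>\<close>

lemma b_in [simp]: "b \<in> PC"
  using mid_identity_b by (simp add: mid_identity_def)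

lemma mid [simp]: "x \<in> PC \<Longrightarrow> y \<in> PC \<Longrightarrow> x \<cdot> (b \<cdot> y) = x \<cdot> y"
  using mid_identity_b assoc[of x b y] by (simp add: mid_identity_def)

text \<open>Write \<open>u = uvu\<close> by regularity. Inserting the mid-identity \<open>u\<close>
  after the first factor gives \<open>u = uuvu = uu\<close>.\<close>

lemma idem_of_mid_identity:
  assumes "mid_identity P u"
  shows "u \<cdot> u = u"
proof -
  have u: "u \<in> PC" "\<And>x y. x \<in> PC \<Longrightarrow> y \<in> PC \<Longrightarrow> x \<cdot> u \<cdot> y = x \<cdot> y"
    using assms assoc by (simp_all add: mid_identity_def del: assoc) metis
  obtain v where v: "v \<in> PC" "u = u \<cdot> v \<cdot> u"
    using regular u(1) by blast
  then have "u = u \<cdot> u \<cdot> v \<cdot> u"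
    using u(2)[of u "v \<cdot> u"] u(1) by simp
  with v show ?thesis
    by simp
qed

lemma bb [simp]: "b \<cdot> b = b"
  by (rule idem_of_mid_identity) (rule mid_identity_b)

lemma \<phi>_eq_iff: "x \<in> PC \<Longrightarrow> y \<in> PC \<Longrightarrow> \<phi> x = \<phi> y \<longleftrightarrow> b \<cdot> x \<cdot> b = b \<cdot> y \<cdot> b"
  by (metis \<phi>_\<psi> \<phi>_in \<psi>_\<phi>)

lemma W_closed:
  assumes "u \<in> scarrier W" "v \<in> scarrier W"
  shows "sop W u v \<in> scarrier W"
  using assms \<phi>_mult[of "\<psi> u" "\<psi> v"] \<phi>_in[of "\<psi> u \<cdot> \<psi> v"] by simp

lemma b_\<psi> [simp]: "w \<in> scarrier W \<Longrightarrow> b \<cdot> \<psi> w = \<psi> w"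
  and \<psi>_b [simp]: "w \<in> scarrier W \<Longrightarrow> \<psi> w \<cdot> b = \<psi> w"
proof -
  assume w: "w \<in> scarrier W"
  then have eq: "\<psi> w = b \<cdot> \<psi> w \<cdot> b"
    using \<psi>_\<phi>[of "\<psi> w"] by simp
  have "b \<cdot> b \<cdot> \<psi> w \<cdot> b = b \<cdot> \<psi> w \<cdot> b"
    using w by simp
  then show "b \<cdot> \<psi> w = \<psi> w"
    by (metis eq)
  have "(b \<cdot> \<psi> w \<cdot> b) \<cdot> b = b \<cdot> \<psi> w \<cdot> b"
    using w by simp
  then show "\<psi> w \<cdot> b = \<psi> w"
    by (metis eq)
qed

lemma \<psi>_mult:
  assumes "u \<in> scarrier W" "v \<in> scarrier W"
  shows "\<psi> (sop W u v) = \<psi> u \<cdot> \<psi> v"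
proof -
  have "\<psi> (sop W u v) = \<psi> (\<phi> (\<psi> u \<cdot> \<psi> v))"
    using assms by (simp add: \<phi>_mult del: \<psi>_\<phi>)
  also have "\<dots> = (b \<cdot> \<psi> u) \<cdot> (\<psi> v \<cdot> b)"
    using assms by (simp del: b_\<psi> \<psi>_b)
  finally show ?thesis
    using assms by simp
qed

lemma W_left_one:
  assumes "w \<in> scarrier W"
  shows "sop W (\<phi> b) w = w"
  using assms \<phi>_mult[of b "\<psi> w"] by simp

text \<open>\<psi> is multiplicative, and injective because \<phi> undoes it, so associativity is
  inherited from \<open>P\<close>.\<close>

lemma W_assoc:
  assumes "u \<in> scarrier W" "v \<in> scarrier W" "w \<in> scarrier W"
  shows "sop W (sop W u v) w = sop W u (sop W v w)"
proof -
  have "\<psi> (sop W (sop W u v) w) = \<psi> (sop W u (sop W v w))"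
    using assms by (simp add: \<psi>_mult W_closed)
  then show ?thesis
    using assms by (metis W_closed \<phi>_\<psi>)
qed

text \<open>The same \<open>b\<close>, \<phi> and \<psi> serve for the opposite semigroups, so every
  one-sided result below also yields its mirror image.\<close>

lemma dual: "mid_identity_retract (op_sgrp P) (op_sgrp W) b \<phi> \<psi>"
proof
  show "mid_identity (op_sgrp P) b"
    by (simp add: mid_identity_def)
  show "\<exists>y \<in> scarrier (op_sgrp P). x = sop (op_sgrp P) x (sop (op_sgrp P) y x)"
    if "x \<in> scarrier (op_sgrp P)" for x
    using that regular[of x] by (simp; metis assoc)
qed (simp_all add: \<phi>_mult)

lemma idems_iff: "x \<in> sg_idems P \<longleftrightarrow> x \<in> PC \<and> \<phi> x \<in> sg_idems W"
proof
  assume x: "x \<in> PC \<and> \<phi> x \<in> sg_idems W"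
  then have "\<phi> x = \<phi> (x \<cdot> x)"
    by (simp add: sg_idems_def \<phi>_mult)
  then have bx: "b \<cdot> x \<cdot> b = b \<cdot> x \<cdot> x \<cdot> b"
    using x by (simp add: \<phi>_eq_iff)
  obtain z where z: "z \<in> PC" "x = x \<cdot> z \<cdot> x"
    using x regular by blast
  have "x \<cdot> x = (x \<cdot> z \<cdot> x) \<cdot> (x \<cdot> z \<cdot> x)"
    using z by simp
  \<comment> \<open>The middle \<open>xx\<close> is flanked by other factors, so copies of
    \<open>b\<close> may be inserted around it; \<open>bxxb\<close> can then be replaced by
    \<open>bxb\<close>.\<close>
  also have "\<dots> = (x \<cdot> z) \<cdot> (b \<cdot> x \<cdot> x \<cdot> b) \<cdot> (z \<cdot> x)"
    using x z(1) by simp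
  also have "\<dots> = (x \<cdot> z \<cdot> x) \<cdot> z \<cdot> x"
    unfolding bx[symmetric] using x z(1) by simp
  also have "\<dots> = x"
    using z by simp
  finally show "x \<in> sg_idems P"
    using x by (simp add: sg_idems_def)
qed (auto simp: sg_idems_def simp flip: \<phi>_mult)

lemma EP_in: "EP \<subseteq> PC"
  by (rule sg_gen_subset) (auto simp: sg_idems_def)

lemma \<psi>_idems: "w \<in> sg_idems W \<Longrightarrow> \<psi> w \<in> sg_idems P"
  by (simp add: idems_iff) (simp add: sg_idems_def)

lemma idems_W: "sg_idems W = \<phi> ` sg_idems P"
proof
  show "sg_idems W \<subseteq> \<phi> ` sg_idems P"
  proof
    fix w
    assume w: "w \<in> sg_idems W"
    then have "w = \<phi> (\<psi> w)"
      by (simp add: sg_idems_def)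
    with w show "w \<in> \<phi> ` sg_idems P"
      using \<psi>_idems by blast
  qed
qed (use idems_iff in auto)

lemma image_\<phi>_sg_gen: "A \<subseteq> PC \<Longrightarrow> \<phi> ` sg_gen P A = sg_gen W (\<phi> ` A)"
  by (rule image_sg_gen[of _ _ PC]) (auto simp: \<phi>_mult intro: sg_gen_subset[THEN subsetD])

lemma image_\<psi>_sg_gen: "A \<subseteq> scarrier W \<Longrightarrow> \<psi> ` sg_gen W A = sg_gen P (\<psi> ` A)"
  by (rule image_sg_gen[of _ _ "scarrier W"])
    (auto simp: \<psi>_mult W_closed intro: sg_gen_subset[THEN subsetD])

lemma EW_eq: "EW = \<phi> ` EP"
proof -
  have "sg_idems P \<subseteq> PC"
    by (auto simp: sg_idems_def)
  then show ?thesis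
    by (simp add: image_\<phi>_sg_gen idems_W)
qed

lemma EW_in: "EW \<subseteq> scarrier W"
  using EW_eq EP_in by auto

section \<open>The mid-identities, as the preimage of the identity of \<open>W\<close>\<close>

definition mids :: "'a set" where
  "mids = {u \<in> PC. b \<cdot> u \<cdot> b = b}"

lemma mids_iff: "u \<in> mids \<longleftrightarrow> u \<in> PC \<and> \<phi> u = \<phi> b"
  by (auto simp: mids_def \<phi>_eq_iff)

lemma mids_in: "u \<in> mids \<Longrightarrow> u \<in> PC"
  by (simp add: mids_def)

lemma b_mids: "b \<in> mids"
  by (simp add: mids_def)

text \<open>Inserting \<open>b\<close> on both sides of \<open>u\<close> creates
  \<open>bub = b\<close>, and this \<open>b\<close> is absorbed again.\<close>

lemma mids_mid:
  assumes "u \<in> mids" "x \<in> PC" "y \<in> PC"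
  shows "x \<cdot> u \<cdot> y = x \<cdot> y"
proof -
  have u: "u \<in> PC" "b \<cdot> u \<cdot> b = b"
    using assms(1) by (auto simp: mids_def)
  have "x \<cdot> u \<cdot> y = x \<cdot> (b \<cdot> u \<cdot> b) \<cdot> y"
    using u(1) assms(2,3) by simp
  then show ?thesis
    using assms(2,3) u(2) by simp
qed

lemma mid_identity_iff: "mid_identity P u \<longleftrightarrow> u \<in> mids"
proof
  assume "mid_identity P u"
  then have "u \<in> PC" "(b \<cdot> u) \<cdot> b = b \<cdot> b"
    unfolding mid_identity_def using b_in by blast+
  then show "u \<in> mids"
    by (simp add: mids_def)
qed (simp add: mid_identity_def mids_mid mids_in)

lemma mids_idem: "u \<in> mids \<Longrightarrow> u \<cdot> u = u"
  by (rule idem_of_mid_identity) (simp add: mid_identity_iff)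

lemma mids_idems: "mids \<subseteq> sg_idems P"
  by (auto simp: sg_idems_def mids_in mids_idem)

lemma mids_mult:
  assumes "u \<in> mids" "v \<in> mids"
  shows "u \<cdot> v \<in> mids"
  using mids_mid[OF assms(1), of b "v \<cdot> b"] assms by (simp add: mids_def)

text \<open>An idempotent with a right inverse is the identity; this passes to products of
  idempotents one factor at a time.\<close>

lemma mids_factor_left:
  assumes "x \<in> EP" "y \<in> PC" "x \<cdot> y \<in> mids"
  shows "x \<in> mids"
  using assms
\<comment> \<open>The right cofactor must vary: for a product of two factors, the second one joins
  the cofactor of the first.\<close>
proof (induction arbitrary: y)
  case (base e)
  then have e: "e \<in> PC" "e \<cdot> e = e"
    by (auto simp: sg_idems_def)
  have *: "b \<cdot> e \<cdot> y \<cdot> b = b"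
    using base e by (simp add: mids_def)
  have "b \<cdot> e \<cdot> b = (b \<cdot> e) \<cdot> (b \<cdot> e \<cdot> y \<cdot> b)"
    using e * by simp
  also have "\<dots> = b \<cdot> (e \<cdot> e) \<cdot> y \<cdot> b"
    using e(1) base(2) by simp
  finally show ?case
    using e * by (simp add: mids_def)
next
  case (mult x\<^sub>1 x\<^sub>2)
  have in_PC: "x\<^sub>1 \<in> PC" "x\<^sub>2 \<in> PC"
    using mult.hyps EP_in by auto
  have "x\<^sub>1 \<cdot> x\<^sub>2 \<cdot> y \<in> mids"
    using mult.prems in_PC by simp
  then have x1: "x\<^sub>1 \<in> mids"
    using mult.IH(1)[of "x\<^sub>2 \<cdot> y"] mult.prems in_PC by simp
  \<comment> \<open>The first factor is now known to be a mid-identity, so it can be deleted; the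
    second factor is left with cofactor \<open>y\<close>.\<close>
  have "b \<cdot> x\<^sub>1 \<cdot> x\<^sub>2 \<cdot> y \<cdot> b = b \<cdot> x\<^sub>2 \<cdot> y \<cdot> b"
    using mids_mid[OF x1, of b "x\<^sub>2 \<cdot> y \<cdot> b"] in_PC mult.prems by simp
  then have "x\<^sub>2 \<cdot> y \<in> mids"
    using mult.prems in_PC by (simp add: mids_def)
  then have "x\<^sub>2 \<in> mids"
    using mult.IH(2) mult.prems by blast
  with x1 show ?case
    using mids_mult by blast
qed

lemma mids_factors:
  assumes "x \<in> EP" "y \<in> EP" "x \<cdot> y \<in> mids"
  shows "x \<in> mids" "y \<in> mids"
proof -
  have in_PC: "x \<in> PC" "y \<in> PC"
    using assms EP_in by auto
  show x: "x \<in> mids"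
    using mids_factor_left assms in_PC by blast
  show "y \<in> mids"
    using mids_mid[OF x, of b "y \<cdot> b"] assms(3) in_PC by (simp add: mids_def)
qed

text \<open>If \<open>uv\<close> is the identity, lifts of \<open>u\<close> and \<open>v\<close> to
  \<open>EP\<close> have a product in \<open>mids\<close>, hence lie in \<open>mids\<close>
  themselves, and \<open>u = v = \<phi> b\<close>. The identity is therefore never a product of
  other elements of \<open>EW\<close>.\<close>

lemma one_in_generating_set:
  assumes "B \<subseteq> EW" "\<phi> b \<in> sg_gen W B"
  shows "\<phi> b \<in> B"
proof -
  have "\<phi> b \<in> B" if "w \<in> sg_gen W B" "w = \<phi> b" for w
    using that
  proof induction
    case (mult u v)
    have "u \<in> EW" "v \<in> EW"
      using mult.hyps sg_gen_least[OF assms(1)] by auto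
    then obtain x y where xy: "x \<in> EP" "y \<in> EP" "u = \<phi> x" "v = \<phi> y"
      using EW_eq by auto
    moreover have "x \<in> PC" "y \<in> PC"
      using xy EP_in by auto
    ultimately have "x \<cdot> y \<in> mids"
      using mult.prems by (simp add: mids_iff \<phi>_mult)
    then have "x \<in> mids"
      using mids_factors xy by blast
    then show ?case
      using mult.IH xy by (simp add: mids_iff)
  qed auto
  then show ?thesis
    using assms(2) by blast
qed

text \<open>All factors of \<open>u\<close> lie in \<open>mids\<close>, and there
  \<open>xyb = xb\<close>: the row of a product is that of its first factor. So each row meets
  \<open>A\<close>, which gives the bound by the number of rows.\<close>

lemma mids_row_representative:
  assumes "A \<subseteq> EP" "u \<in> sg_gen P A" "u \<in> mids"
  shows "u \<cdot> b \<in> (\<lambda>x. x \<cdot> b) ` (A \<inter> mids)"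
  using assms(2,3)
proof induction
  case (mult x y)
  have E: "x \<in> EP" "y \<in> EP"
    using mult.hyps sg_gen_least[OF assms(1)] by auto
  then have "x \<in> mids" "y \<in> mids"
    using mids_factors mult.prems by blast+
  moreover from this have "(x \<cdot> y) \<cdot> b = x \<cdot> b"
    by (simp add: mids_in mids_mid)
  ultimately show ?case
    using mult.IH by simp
qed auto

section \<open>Rows and columns of the band of mid-identities, and Green's classes\<close>

definition rows :: "'a set" where "rows = (\<lambda>u. u \<cdot> b) ` mids"
definition cols :: "'a set" where "cols = (\<lambda>u. b \<cdot> u) ` mids"

text \<open>The preimage under \<phi> of the group of units of \<open>W\<close>; in the application
  this is \<open>H_hat\<close>.\<close>

definition hat :: "'a set" where
  "hat = {y \<in> PC. (\<phi> y, \<phi> b) \<in> green_H W}"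

lemma mids_op: "mid_identity_retract.mids (op_sgrp P) b = mids"
  by (auto simp: mid_identity_retract.mids_def[OF dual] mids_def)

lemma rows_op: "mid_identity_retract.rows (op_sgrp P) b = cols"
  by (auto simp: mid_identity_retract.rows_def[OF dual] cols_def mids_op)

lemma hat_op: "mid_identity_retract.hat (op_sgrp P) (op_sgrp W) b \<phi> = hat"
  by (auto simp: mid_identity_retract.hat_def[OF dual] hat_def green_H_op_sgrp)

lemma mids_col_representative:
  assumes "A \<subseteq> EP" "u \<in> sg_gen P A" "u \<in> mids"
  shows "b \<cdot> u \<in> (\<lambda>x. b \<cdot> x) ` (A \<inter> mids)"
  using mid_identity_retract.mids_row_representative[OF dual, of A u] assms
  by (simp add: mids_op sg_gen_op_sgrp sg_idems_op_sgrp)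

lemma hat_right_inverse:
  assumes "y \<in> hat"
  shows "\<exists>s \<in> PC. b \<cdot> y \<cdot> s \<cdot> b = b"
proof -
  have y: "y \<in> PC" "(\<phi> y, \<phi> b) \<in> green_R W"
    using assms by (auto simp: hat_def green_H_def)
  then have "\<phi> y = \<phi> b \<or> (\<exists>t \<in> scarrier W. \<phi> b = sop W (\<phi> y) t)"
    by (subst (asm) green_R_iff[OF W_closed W_assoc]) auto
  \<comment> \<open>This supplies the multiplier \<open>\<phi> b\<close> when the two related
    elements are equal.\<close>
  moreover have "\<phi> b = sop W (\<phi> b) (\<phi> b)"
    using W_left_one[of "\<phi> b"] by simp
  ultimately obtain t where t: "t \<in> scarrier W" "\<phi> b = sop W (\<phi> y) t"
    using \<phi>_in[OF b_in] by metis
  then have "\<phi> b = \<phi> (y \<cdot> \<psi> t)"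
    using y by (simp add: \<phi>_mult)
  then have "b \<cdot> y \<cdot> \<psi> t \<cdot> b = b"
    using y t(1) by (subst (asm) \<phi>_eq_iff) auto
  then show ?thesis
    using t(1) \<psi>_in by blast
qed

lemma mids_hat: "mids \<subseteq> hat"
  by (auto simp: mids_iff hat_def green_H_def green_R_def green_L_def)

lemma rows_mids: "rows \<subseteq> mids"
  by (auto simp: rows_def intro: mids_mult b_mids)

text \<open>Each \<R>-class of \<open>hat\<close> contains exactly one element of
  \<open>rows\<close>, so the row labels \<open>ub\<close> form a transversal.\<close>

lemma quotient_green_R_hat: "|hat // Restr (green_R P) hat| =o |rows|"
proof -
  let ?R = "Restr (green_R P) hat"
  have equiv: "equiv hat ?R"
    by (auto simp: equiv_def refl_on_def sym_def trans_def green_R_def hat_def)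
  have "bij_betw (\<lambda>v. ?R `` {v}) rows (hat // ?R)"
  proof (intro bij_betw_imageI inj_onI)
    fix v w
    assume vw: "v \<in> rows" "w \<in> rows" "?R `` {v} = ?R `` {w}"
    then have mids: "v \<in> mids" "w \<in> mids"
      using rows_mids by auto
    then have "(v, w) \<in> green_R P"
      using vw(3) mids_hat equiv eq_equiv_class_iff[OF equiv, of v w] by auto
    then consider "v = w" | t where "t \<in> PC" "w = v \<cdot> t"
      by (auto simp: green_R_iff)
    then show "v = w"
    proof cases
      case (2 t)
      have "v \<cdot> v \<cdot> t = v \<cdot> t"
        using mids 2 mids_mid[of v v t] by (simp add: mids_in)
      then have "w = v \<cdot> w"
        using 2 by simp
      \<comment> \<open>With \<open>v = pb\<close> and \<open>w = qb\<close>, the mid-identity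
        \<open>q\<close> drops out of \<open>pbqb\<close>.\<close>
      also have "v \<cdot> w = v"
        using vw mids by (auto simp: rows_def mids_in mids_mid)
      finally show ?thesis ..
    qed
  next
    have "?R `` {y} \<in> (\<lambda>v. ?R `` {v}) ` rows" if y: "y \<in> hat" for y
    proof -
      have y_in: "y \<in> PC"
        using y by (simp add: hat_def)
      obtain s where s: "s \<in> PC" "b \<cdot> y \<cdot> s \<cdot> b = b"
        using hat_right_inverse y by blast
      obtain z where z: "z \<in> PC" "y = y \<cdot> z \<cdot> y"
        using regular y_in by blast
      \<comment> \<open>The right inverse makes \<open>ys\<close> a mid-identity, and the final
        \<open>b\<close> turns it into a row label.\<close>
      let ?v = "y \<cdot> s \<cdot> b"
      have "y \<cdot> s \<in> mids"
        using s y_in by (simp add: mids_def)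
      then have v: "?v \<in> rows"
        unfolding rows_def using s y_in by (auto intro!: image_eqI[of _ _ "y \<cdot> s"])
      have "?v \<cdot> y = (y \<cdot> s) \<cdot> y"
        using s y_in by simp
      \<comment> \<open>Expanding both outer copies of \<open>y\<close> exposes \<open>ys\<close>
        with factors on either side, so that \<open>bysb = b\<close> can be applied.\<close>
      also have "\<dots> = (y \<cdot> z \<cdot> y) \<cdot> s \<cdot> (y \<cdot> z \<cdot> y)"
        using z s y_in by simp
      also have "\<dots> = (y \<cdot> z) \<cdot> (b \<cdot> y \<cdot> s \<cdot> b) \<cdot> (y \<cdot> z \<cdot> y)"
        using z(1) s(1) y_in by simp
      also have "\<dots> = (y \<cdot> z \<cdot> y) \<cdot> z \<cdot> y"
        unfolding s(2) using z(1) y_in by simp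
      also have "\<dots> = y"
        using z by simp
      finally have "y = ?v \<cdot> y" ..
      moreover have "?v = y \<cdot> (s \<cdot> b)"
        using s y_in by simp
      ultimately have "(y, ?v) \<in> green_R P"
        using s(1) y_in by (subst green_R_iff) (auto intro: bexI[of _ "s \<cdot> b"])
      then have "?R `` {y} = ?R `` {?v}"
        using y v rows_mids mids_hat by (intro equiv_class_eq[OF equiv]) auto
      with v show ?thesis
        by blast
    qed
    then show "(\<lambda>v. ?R `` {v}) ` rows = hat // ?R"
      using rows_mids mids_hat by (auto simp: quotient_def)
  qed
  then show ?thesis
    using card_of_ordIsoI ordIso_symmetric by blast
qed

lemma quotient_green_L_hat: "|hat // Restr (green_L P) hat| =o |cols|"
  using mid_identity_retract.quotient_green_R_hat[OF dual]
  by (simp add: hat_op rows_op green_op_sgrp)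

text \<open>A subset meeting every row and every column generates the band by products of two. The
  larger of the two index sets suffices to label such a subset; the disjunction expresses the bound
  by the maximum.\<close>

lemma mids_generating_set:
  "\<exists>B \<subseteq> mids. ( |B| \<le>o |rows| \<or> |B| \<le>o |cols| ) \<and> mids \<subseteq> sg_gen P B"
proof -
  \<comment> \<open>\<open>pq\<close> is the band element in row \<open>p\<close> and column
    \<open>q\<close>.\<close>
  have pq: "p \<cdot> q \<in> mids \<and> (p \<cdot> q) \<cdot> b = p \<and> b \<cdot> (p \<cdot> q) = q"
    if pq: "p \<in> rows" "q \<in> cols" for p q
  proof -
    obtain u v where "u \<in> mids" "v \<in> mids" "p = u \<cdot> b" "q = b \<cdot> v"
      using pq by (auto simp: rows_def cols_def)
    then show ?thesis
      using mids_mult[of u v] by (auto simp: mids_in mids_mid)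
  qed
  \<comment> \<open>Take \<open>x\<close> from the row of \<open>u\<close> and \<open>y\<close> from
    its column; then \<open>xy = u\<close>.\<close>
  have gen: "mids \<subseteq> sg_gen P B"
    if "B \<subseteq> mids" "rows \<subseteq> (\<lambda>x. x \<cdot> b) ` B" "cols \<subseteq> (\<lambda>x. b \<cdot> x) ` B" for B
  proof
    fix u
    assume u: "u \<in> mids"
    then have "u \<cdot> b \<in> rows" "b \<cdot> u \<in> cols"
      by (auto simp: rows_def cols_def)
    with that obtain x y where xy: "x \<in> B" "y \<in> B" "u \<cdot> b = x \<cdot> b" "b \<cdot> u = b \<cdot> y"
      by blast
    have in_PC: "x \<in> PC" "y \<in> PC" "u \<in> PC"
      using xy that u mids_in by auto
    have "x \<cdot> y = (x \<cdot> b) \<cdot> (b \<cdot> y)"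
      using in_PC by simp
    also have "\<dots> = (u \<cdot> b) \<cdot> (b \<cdot> u)"
      using xy by simp
    also have "\<dots> = u"
      using in_PC u by (simp add: mids_idem)
    finally show "u \<in> sg_gen P B"
      using sg_gen.mult[OF sg_gen.base sg_gen.base] xy by metis
  qed
  have ne: "rows \<noteq> {}" "cols \<noteq> {}"
    using b_mids by (auto simp: rows_def cols_def)
  \<comment> \<open>\<open>Z\<close> is a set of cells of the rectangle that projects onto all rows
    and onto all columns. Below it is the graph of a surjection from the larger side onto the
    smaller.\<close>
  have *: ?thesis
    if Z: "fst ` Z = rows" "snd ` Z = cols" "|Z| \<le>o |rows| \<or> |Z| \<le>o |cols|" for Z
  proof (intro exI[of _ "(\<lambda>(p, q). p \<cdot> q) ` Z"] conjI)
    have Z_pq: "p \<cdot> q \<in> mids" "(p \<cdot> q) \<cdot> b = p" "b \<cdot> (p \<cdot> q) = q" if "(p, q) \<in> Z" for p q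
      using pq[of p q] Z that by force+
    show sub: "(\<lambda>(p, q). p \<cdot> q) ` Z \<subseteq> mids"
      using Z_pq(1) by auto
    have "(\<lambda>x. x \<cdot> b) ` (\<lambda>(p, q). p \<cdot> q) ` Z = fst ` Z"
      unfolding image_image by (rule image_cong) (use Z_pq(2) in auto)
    moreover have "(\<lambda>x. b \<cdot> x) ` (\<lambda>(p, q). p \<cdot> q) ` Z = snd ` Z"
      unfolding image_image by (rule image_cong) (use Z_pq(3) in auto)
    ultimately show "mids \<subseteq> sg_gen P ((\<lambda>(p, q). p \<cdot> q) ` Z)"
      using gen[OF sub] Z(1,2) by simp
    show "|(\<lambda>(p, q). p \<cdot> q) ` Z| \<le>o |rows| \<or> |(\<lambda>(p, q). p \<cdot> q) ` Z| \<le>o |cols|"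
      using Z(3) ordLeq_transitive[OF card_of_image] by metis
  qed
  consider "|rows| \<le>o |cols|" | "|cols| \<le>o |rows|"
    using ordLeq_total card_of_Well_order by blast
  then show ?thesis
  proof cases
    case 1
    then obtain g where "g ` cols = rows"
      using card_of_ordLeq2[OF ne(1), THEN iffD2] by blast
    then show ?thesis
      by (intro *[of "(\<lambda>q. (g q, q)) ` cols"]) (auto simp: image_image card_of_image)
  next
    case 2
    then obtain g where "g ` rows = cols"
      using card_of_ordLeq2[OF ne(2), THEN iffD2] by blast
    then show ?thesis
      by (intro *[of "(\<lambda>p. (p, g p)) ` rows"]) (auto simp: image_image card_of_image)
  qed
qed

text \<open>From \<open>e = fu = ug\<close> and \<open>uu = u\<close> follow
  \<open>eu = e = ue\<close>, hence \<open>e = ueu\<close>. This splits \<open>e\<close> into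
  mid-identities and the element \<open>beb = \<psi> (\<phi> e)\<close>, which comes from
  \<open>W\<close>.\<close>

lemma idem_below_mid:
  assumes "MI_dominated P" "e \<in> sg_idems P"
  shows "\<exists>u \<in> mids. e = u \<cdot> (b \<cdot> e \<cdot> b) \<cdot> u"
proof -
  obtain u where u: "u \<in> mids" "natural_le P e u"
    using assms by (auto simp: MI_dominated_def mid_identity_iff)
  then obtain f g where fg: "f \<in> PC" "g \<in> PC" "e = f \<cdot> u" "e = u \<cdot> g"
    by (auto simp: natural_le_def sg_idems_def)
  have in_PC: "u \<in> PC" "e \<in> PC"
    using u assms(2) by (auto simp: mids_in sg_idems_def)
  have "e \<cdot> u = e"
    using fg(1,3) in_PC u by (simp add: mids_idem)
  moreover have "u \<cdot> e = e"
    using fg(2,4) in_PC u by (metis assoc mids_idem)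
  moreover have "u \<cdot> (b \<cdot> e \<cdot> b) \<cdot> u = u \<cdot> e \<cdot> u"
    using in_PC by simp
  ultimately show ?thesis
    using u(1) by metis
qed

section \<open>The two bounds, for rank and idempotent rank at once\<close>

text \<open>The parameters \<open>X\<close> and \<open>Y\<close> are the sets from which generators may be chosen:
  all elements for the rank, the idempotents for the idempotent rank.\<close>

context
  fixes X :: "'a set" and Y :: "'b set" and r :: "'c rel" and l :: "'c rel"
  assumes X: "sg_idems P \<subseteq> X" "X \<subseteq> EP"
    and Y: "sg_idems W \<subseteq> Y" "Y \<subseteq> EW"
    and XY: "\<phi> ` X \<subseteq> Y" "\<psi> ` Y \<subseteq> X"
    and rl: "r =o |rows|" "l =o |cols|"
begin

abbreviation "kP \<equiv> min_card {A. A \<subseteq> X \<and> sg_gen P A = EP}"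
abbreviation "kW \<equiv> min_card {A. A \<subseteq> Y \<and> sg_gen W A = EW}"

lemma Card_order_rl: "Card_order r" "Card_order l"
  using rl by (auto intro: Card_order_ordIso[OF card_of_Card_order])

lemma kW_attained:
  obtains B where "B \<subseteq> Y" "sg_gen W B = EW" "\<phi> b \<in> B" "kW = |B|"
    "\<forall>C \<subseteq> Y. sg_gen W C = EW \<longrightarrow> |B| \<le>o |C|"
proof -
  have ne: "{A. A \<subseteq> Y \<and> sg_gen W A = EW} \<noteq> {}"
    using Y by blast
  obtain B where B: "B \<subseteq> Y" "sg_gen W B = EW" "kW = |B|"
    using min_card_attained_and_least(1)[OF ne] by blast
  have "b \<in> EP"
    using b_mids mids_idems by (intro sg_gen.base) blast
  then have "\<phi> b \<in> EW"
    by (simp add: EW_eq)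
  then have "\<phi> b \<in> B"
    using one_in_generating_set[of B] B Y by blast
  moreover have "\<forall>C \<subseteq> Y. sg_gen W C = EW \<longrightarrow> |B| \<le>o |C|"
    using min_card_attained_and_least(2)[OF ne] B(3) by simp
  ultimately show thesis
    using that B by blast
qed

lemma rank_lower: "cpred (kW +c cmax r l) \<le>o kP"
proof -
  have "{A. A \<subseteq> X \<and> sg_gen P A = EP} \<noteq> {}"
    using X by blast
  from min_card_attained_and_least(1)[OF this]
  obtain A where A: "A \<subseteq> X" "sg_gen P A = EP" "kP = |A|"
    by blast
  obtain B where "B \<subseteq> Y" "sg_gen W B = EW" and B: "\<phi> b \<in> B" "kW = |B|"
    "\<forall>C \<subseteq> Y. sg_gen W C = EW \<longrightarrow> |B| \<le>o |C|"
    by (rule kW_attained)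
  have A_EP: "A \<subseteq> EP"
    using A X by blast
  have mids_gen: "u \<in> sg_gen P A" if "u \<in> mids" for u
    unfolding A(2) using that mids_idems by (intro sg_gen.base) blast
  have "rows \<subseteq> (\<lambda>x. x \<cdot> b) ` (A \<inter> mids)"
    unfolding rows_def by (intro image_subsetI mids_row_representative[OF A_EP mids_gen])
  then have "|rows| \<le>o |A \<inter> mids|"
    by (rule surj_imp_ordLeq)
  with rl(1) have r: "r \<le>o |A \<inter> mids|"
    by (rule ordIso_ordLeq_trans)
  have "cols \<subseteq> (\<lambda>x. b \<cdot> x) ` (A \<inter> mids)"
    unfolding cols_def by (intro image_subsetI mids_col_representative[OF A_EP mids_gen])
  then have "|cols| \<le>o |A \<inter> mids|"
    by (rule surj_imp_ordLeq)
  with rl(2) have l: "l \<le>o |A \<inter> mids|"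
    by (rule ordIso_ordLeq_trans)
  obtain x where "x \<in> A" "x \<in> mids"
    using mids_row_representative[OF A_EP mids_gen[OF b_mids] b_mids] by auto
  \<comment> \<open>All of \<open>A \<inter> mids\<close>, which is nonempty, collapses to the
    single point \<open>\<phi> b\<close>, and nothing else in \<open>A\<close> is sent
    there.\<close>
  then have C: "\<phi> ` A = insert (\<phi> b) (\<phi> ` (A - mids))"
    by (auto simp: mids_iff intro: rev_image_eqI[of x])
  have not_in: "\<phi> b \<notin> \<phi> ` (A - mids)"
    using A_EP EP_in by (auto simp: mids_iff)
  have "sg_gen W (\<phi> ` A) = EW"
    using image_\<phi>_sg_gen[of A] A_EP EP_in A(2) EW_eq by simp
  moreover have "\<phi> ` A \<subseteq> Y"
    using A(1) XY(1) by blast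
  ultimately have "|B| \<le>o |insert (\<phi> b) (\<phi> ` (A - mids))|"
    unfolding C[symmetric] using B(3) by blast
  \<comment> \<open>Removing the identity from both sides accounts for the 1 subtracted in the
    bound.\<close>
  from ordLeq_diff_singleton[OF this B(1), of "\<phi> b"]
  have "|B - {\<phi> b}| \<le>o |\<phi> ` (A - mids)|"
    using not_in by simp
  then have "|B - {\<phi> b}| \<le>o |A - mids|"
    using card_of_image by (rule ordLeq_transitive)
  then have "|B - {\<phi> b}| +c cmax r l \<le>o |A - mids| +c |A \<inter> mids|"
    using cmax_least[OF r l] by (rule csum_mono)
  moreover have "|A - mids| +c |A \<inter> mids| \<le>o |A|"
    by (rule csum_Diff_Int)
  ultimately have "|B - {\<phi> b}| +c cmax r l \<le>o |A|"
    by (rule ordLeq_transitive)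
  then show ?thesis
    unfolding A(3) B(2)
    by (rule ordIso_ordLeq_trans[OF cpred_csum[OF Card_order_cmax[OF Card_order_rl] B(1)]])
qed

lemma rank_eq:
  assumes "MI_dominated P"
  shows "kP =o cpred (kW +c cmax r l)"
proof -
  obtain B where B: "B \<subseteq> Y" "sg_gen W B = EW" "\<phi> b \<in> B" "kW = |B|"
    by (rule kW_attained)
  obtain U where U: "U \<subseteq> mids" "|U| \<le>o |rows| \<or> |U| \<le>o |cols|" "mids \<subseteq> sg_gen P U"
    using mids_generating_set by blast
  have B_in: "B \<subseteq> scarrier W"
    using B Y EW_in by blast
  \<comment> \<open>The identity can be left out of \<open>B\<close> because
    \<open>\<psi> (\<phi> b) = b\<close> is a mid-identity, already generated by \<open>U\<close>.
    This saves one generator.\<close>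
  let ?A = "\<psi> ` (B - {\<phi> b}) \<union> U"
  have "?A \<subseteq> X"
    using B XY U mids_idems X by blast
  have mids_A: "mids \<subseteq> sg_gen P ?A"
    using U(3) sg_gen_mono[of U ?A] by blast
  then have b_A: "b \<in> sg_gen P ?A"
    using b_mids by blast
  have "\<psi> w \<in> sg_gen P ?A" if "w \<in> B" for w
  proof (cases "w = \<phi> b")
    case True
    then show ?thesis
      using b_A by simp
  next
    case False
    then show ?thesis
      using that by (intro sg_gen.base) blast
  qed
  then have "sg_gen P (\<psi> ` B) \<subseteq> sg_gen P ?A"
    by (intro sg_gen_least) auto
  then have EW_A: "\<psi> ` EW \<subseteq> sg_gen P ?A"
    using image_\<psi>_sg_gen[OF B_in] B(2) by simp
  have "sg_idems P \<subseteq> sg_gen P ?A"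
  proof
    fix e
    assume e: "e \<in> sg_idems P"
    then obtain u where u: "u \<in> mids" "e = u \<cdot> (b \<cdot> e \<cdot> b) \<cdot> u"
      using idem_below_mid assms by blast
    have "\<phi> e \<in> EW"
      using e by (intro sg_gen.base) (simp add: idems_W)
    then have "b \<cdot> e \<cdot> b \<in> sg_gen P ?A"
      using EW_A e \<psi>_\<phi>[of e] by (force simp: sg_idems_def)
    then show "e \<in> sg_gen P ?A"
      using u mids_A sg_gen.mult by (metis subsetD)
  qed
  then have "EP \<subseteq> sg_gen P ?A"
    by (rule sg_gen_least)
  moreover have "sg_gen P ?A \<subseteq> EP"
    using \<open>?A \<subseteq> X\<close> X(2) by (intro sg_gen_least) blast
  ultimately have gen: "sg_gen P ?A = EP"
    by blast
  have mem: "?A \<in> {A. A \<subseteq> X \<and> sg_gen P A = EP}"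
    using gen \<open>?A \<subseteq> X\<close> by blast
  then have ne: "{A. A \<subseteq> X \<and> sg_gen P A = EP} \<noteq> {}"
    by blast
  have "kP \<le>o |?A|"
    using min_card_attained_and_least(2)[OF ne] mem by blast
  also have "|?A| \<le>o |\<psi> ` (B - {\<phi> b})| +c |U|"
    by (rule Un_csum)
  also have "|\<psi> ` (B - {\<phi> b})| +c |U| \<le>o |B - {\<phi> b}| +c cmax r l"
  proof (rule csum_mono)
    have "|rows| \<le>o cmax r l" "|cols| \<le>o cmax r l"
      using rl[THEN ordIso_symmetric] cmax_upper[OF Card_order_rl]
      by (auto intro: ordIso_ordLeq_trans)
    then show "|U| \<le>o cmax r l"
      using U(2) by (auto intro: ordLeq_transitive)
  qed (rule card_of_image)
  also have "|B - {\<phi> b}| +c cmax r l =o cpred (kW +c cmax r l)"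
    unfolding B(4)
    by (rule ordIso_symmetric) (rule cpred_csum[OF Card_order_cmax[OF Card_order_rl] B(3)])
  finally show ?thesis
    using rank_lower by (simp add: ordIso_iff_ordLeq)
qed

end

lemma sg_rank_conv: "sg_rank (idem_gen T) = min_card {A. A \<subseteq> sg_gen T (sg_idems T) \<and>
    sg_gen T A = sg_gen T (sg_idems T)}"
  by (simp add: sg_rank_def scarrier_idem_gen sg_gen_idem_gen)

text \<open>All idempotents of \<open>T\<close> survive in \<open>idem_gen T\<close>, so generators
  may be chosen among the idempotents of \<open>T\<close>.\<close>

lemma sg_idrank_conv:
  assumes "\<And>x y. x \<in> scarrier T \<Longrightarrow> y \<in> scarrier T \<Longrightarrow> sop T x y \<in> scarrier T"
  shows "sg_idrank (idem_gen T) = min_card {A. A \<subseteq> sg_idems T \<and>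
    sg_gen T A = sg_gen T (sg_idems T)}"
proof -
  have "sg_gen T (sg_idems T) \<subseteq> scarrier T"
    by (rule sg_gen_subset) (auto simp: sg_idems_def assms)
  moreover have "sg_idems T \<subseteq> sg_gen T (sg_idems T)"
    by (rule sg_gen_superset)
  ultimately have "sg_idems (idem_gen T) = sg_idems T"
    unfolding sg_idems_def idem_gen_def by auto
  then show ?thesis
    by (simp add: sg_idrank_def scarrier_idem_gen sg_gen_idem_gen)
qed

theorem rank_idem_gen:
  fixes r l :: "'c rel"
  assumes "r =o |rows|" "l =o |cols|"
  shows "cpred (sg_rank (idem_gen W) +c cmax r l) \<le>o sg_rank (idem_gen P)"
    and "MI_dominated P \<Longrightarrow>
      sg_rank (idem_gen P) =o cpred (sg_rank (idem_gen W) +c cmax r l)"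
proof -
  have "\<psi> ` EW = sg_gen P (\<psi> ` sg_idems W)"
    by (rule image_\<psi>_sg_gen) (auto simp: sg_idems_def)
  also have "\<dots> \<subseteq> EP"
    by (rule sg_gen_mono) (auto simp: \<psi>_idems)
  finally have \<psi>: "\<psi> ` EW \<subseteq> EP" .
  \<comment> \<open>The assumptions on the generator sets for \<open>X = EP\<close> and
    \<open>Y = EW\<close>.\<close>
  have *: "sg_idems P \<subseteq> EP" "EP \<subseteq> EP" "sg_idems W \<subseteq> EW" "EW \<subseteq> EW"
      "\<phi> ` EP \<subseteq> EW" "\<psi> ` EW \<subseteq> EP"
    by (simp_all add: \<psi> EW_eq sg_gen_superset flip: EW_eq)
  show "cpred (sg_rank (idem_gen W) +c cmax r l) \<le>o sg_rank (idem_gen P)"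
    unfolding sg_rank_conv by (rule rank_lower[OF * assms])
  show "sg_rank (idem_gen P) =o cpred (sg_rank (idem_gen W) +c cmax r l)" if "MI_dominated P"
    unfolding sg_rank_conv by (rule rank_eq[OF * assms that])
qed

theorem idrank_idem_gen:
  fixes r l :: "'c rel"
  assumes "r =o |rows|" "l =o |cols|"
  shows "cpred (sg_idrank (idem_gen W) +c cmax r l) \<le>o sg_idrank (idem_gen P)"
    and "MI_dominated P \<Longrightarrow>
      sg_idrank (idem_gen P) =o cpred (sg_idrank (idem_gen W) +c cmax r l)"
proof -
  \<comment> \<open>The same assumptions, now with the idempotents as \<open>X\<close> and
    \<open>Y\<close>.\<close>
  have *: "sg_idems P \<subseteq> sg_idems P" "sg_idems P \<subseteq> EP" "sg_idems W \<subseteq> sg_idems W"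
      "sg_idems W \<subseteq> EW" "\<phi> ` sg_idems P \<subseteq> sg_idems W" "\<psi> ` sg_idems W \<subseteq> sg_idems P"
    by (simp_all add: sg_gen_superset image_subsetI \<psi>_idems flip: idems_W)
  have idrank: "sg_idrank (idem_gen P) = min_card {A. A \<subseteq> sg_idems P \<and> sg_gen P A = EP}"
      "sg_idrank (idem_gen W) = min_card {A. A \<subseteq> sg_idems W \<and> sg_gen W A = EW}"
    by (rule sg_idrank_conv, simp add: W_closed)+
  show "cpred (sg_idrank (idem_gen W) +c cmax r l) \<le>o sg_idrank (idem_gen P)"
    unfolding idrank
    by (rule rank_lower[OF * assms])
  show "sg_idrank (idem_gen P) =o cpred (sg_idrank (idem_gen W) +c cmax r l)"
    if "MI_dominated P"
    unfolding idrank
    by (rule rank_eq[OF * assms that])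
qed

end


section \<open>Sandwich semigroups\<close>

context partial_semigroup
begin

text \<open>A totalized product, so that composable words can be normalized by rewriting; it carries
  meaning only where the partial product is defined.\<close>

definition comp (infixr "\<bullet>" 70) where "x \<bullet> y = the (pmult S x y)"

lemma pmult_eq_Some:
  assumes "x \<in> elts S" "y \<in> elts S" "rho S x = lam S y"
  shows "pmult S x y = Some (x \<bullet> y)"
  using pmult_defined[OF assms(1,2)] assms(3) by (auto simp: comp_def)

lemma comp_simps [simp]:
  assumes "x \<in> elts S" "y \<in> elts S" "rho S x = lam S y"
  shows "x \<bullet> y \<in> elts S" "lam S (x \<bullet> y) = lam S x" "rho S (x \<bullet> y) = rho S y"
  using pmult_eq_Some[OF assms] pmult_in lam_pmult rho_pmult assms by blast+

lemma comp_assoc [simp]: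
  assumes "x \<in> elts S" "y \<in> elts S" "z \<in> elts S" "rho S x = lam S y" "rho S y = lam S z"
  shows "(x \<bullet> y) \<bullet> z = x \<bullet> y \<bullet> z"
  using pmult_assoc[OF assms(1-3) pmult_eq_Some pmult_eq_Some] assms by (simp add: comp_def)

lemma pmult3_eq_Some:
  assumes "x \<in> elts S" "y \<in> elts S" "z \<in> elts S" "rho S x = lam S y" "rho S y = lam S z"
  shows "pmult3 S x y z = Some (x \<bullet> y \<bullet> z)"
  using assms by (simp add: pmult3_def pmult_eq_Some)

lemma prod3_eq:
  assumes "x \<in> elts S" "y \<in> elts S" "z \<in> elts S" "rho S x = lam S y" "rho S y = lam S z"
  shows "prod3 S x y z = x \<bullet> y \<bullet> z"
  using assms by (simp add: prod3_def pmult3_eq_Some)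

text \<open>Definedness of \<open>xyx\<close> already forces \<open>y\<close> to run opposite to
  \<open>x\<close>; this locates the hom-set of an inverse.\<close>

lemma pmult3_selfD:
  assumes "x \<in> elts S" "y \<in> elts S" "pmult3 S x y x = Some z"
  shows "rho S x = lam S y" "rho S y = lam S x" "x \<bullet> y \<bullet> x = z"
proof -
  obtain w where w: "pmult S x y = Some w" "pmult S w x = Some z"
    using assms(3) by (auto simp: pmult3_def bind_eq_Some_conv)
  show 1: "rho S x = lam S y"
    using pmult_defined[OF assms(1,2)] w(1) by simp
  have "w \<in> elts S"
    using pmult_in assms w by blast
  then show 2: "rho S y = lam S x"
    using pmult_defined[of w x] rho_pmult[OF assms(1,2) w(1)] assms(1) w(2) by simp
  show "x \<bullet> y \<bullet> x = z"
    using assms 1 2 by (simp add: pmult3_eq_Some)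
qed

end

locale sandwich = partial_semigroup S for S :: "('s, 'i) partial_sg" +
  fixes i j :: 'i and a b :: 's
  assumes sandwich_regular: "sandwich_regular S i j a"
    and b_inverse: "b \<in> pinverses S a"
begin

lemma a_in [simp]: "a \<in> elts S" "lam S a = j" "rho S a = i"
  using sandwich_regular by (auto simp: sandwich_regular_def hom_set_def)

lemma b_in [simp]: "b \<in> elts S" "lam S b = i" "rho S b = j"
  and aba: "a \<bullet> b \<bullet> a = a" and bab: "b \<bullet> a \<bullet> b = b"
proof -
  have b: "b \<in> elts S" "pmult3 S a b a = Some a" "pmult3 S b a b = Some b"
    using b_inverse by (auto simp: pinverses_def)
  show "b \<in> elts S" by fact
  show "lam S b = i" "rho S b = j" "a \<bullet> b \<bullet> a = a" "b \<bullet> a \<bullet> b = b"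
    using pmult3_selfD[OF _ _ b(2)] pmult3_selfD[OF _ _ b(3)] b(1) by simp_all
qed

text \<open>The form of \<open>aba = a\<close> that matches inside right-associated words.\<close>

lemma aba' [simp]:
  assumes "x \<in> elts S" "lam S x = i"
  shows "a \<bullet> b \<bullet> a \<bullet> x = a \<bullet> x"
proof -
  have "(a \<bullet> b \<bullet> a) \<bullet> x = a \<bullet> b \<bullet> a \<bullet> x"
    using assms by (simp del: aba)
  then show ?thesis
    by (simp add: aba)
qed

lemma hom_iff: "x \<in> hom_set S i j \<longleftrightarrow> x \<in> elts S \<and> lam S x = i \<and> rho S x = j"
  by (simp add: hom_set_def)

section \<open>Regularity in the sandwich semigroup\<close>

abbreviation "T \<equiv> sandwich_sg S i j a"
abbreviation "P \<equiv> P_sg S i j a"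
abbreviation "W \<equiv> W_sg S i j a b"

lemma T_carrier [simp]: "scarrier T = hom_set S i j"
  by (simp add: sandwich_sg_def)

lemma T_op [simp]:
  "x \<in> hom_set S i j \<Longrightarrow> y \<in> hom_set S i j \<Longrightarrow> sop T x y = x \<bullet> a \<bullet> y"
  by (simp add: sandwich_sg_def prod3_eq hom_iff)

lemma T_closed:
  "x \<in> scarrier T \<Longrightarrow> y \<in> scarrier T \<Longrightarrow> sop T x y \<in> scarrier T"
  by (simp add: hom_iff)

lemma T_assoc: "x \<in> scarrier T \<Longrightarrow> y \<in> scarrier T \<Longrightarrow> z \<in> scarrier T
    \<Longrightarrow> sop T (sop T x y) z = sop T x (sop T y z)"
  by (simp add: hom_iff)

lemma P_op: "sop P = sop T"
  by (simp add: P_sg_def)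

lemma P_iff: "x \<in> scarrier P \<longleftrightarrow> x \<in> hom_set S i j \<and>
    (\<exists>y \<in> hom_set S i j. x \<bullet> a \<bullet> y \<bullet> a \<bullet> x = x)"
proof -
  have "sop T (sop T x y) x = x \<bullet> a \<bullet> y \<bullet> a \<bullet> x" if "x \<in> hom_set S i j" "y \<in> hom_set S i j" for y
    using that by (simp add: hom_iff)
  then show ?thesis
    by (auto simp: P_sg_def sg_reg_def) metis+
qed

lemma P_hom: "x \<in> scarrier P \<Longrightarrow> x \<in> hom_set S i j"
  by (simp add: P_iff)

text \<open>Sandwich-regularity provides \<open>t\<close> somewhere in \<open>S\<close>; definedness
  of the product places it in \<open>hom_set S i j\<close>.\<close>

lemma axa_regular:
  assumes "x \<in> hom_set S i j"
  obtains t where "t \<in> hom_set S i j" "a \<bullet> x \<bullet> a \<bullet> t \<bullet> a \<bullet> x \<bullet> a = a \<bullet> x \<bullet> a"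
proof -
  have x: "x \<in> elts S" "lam S x = i" "rho S x = j"
    using assms by (auto simp: hom_iff)
  have "a \<bullet> x \<bullet> a \<in> preg S"
    using sandwich_regular assms x by (auto simp: sandwich_regular_def prod3_eq image_subset_iff)
  then obtain t where t: "t \<in> elts S"
      "pmult3 S (a \<bullet> x \<bullet> a) t (a \<bullet> x \<bullet> a) = Some (a \<bullet> x \<bullet> a)"
    by (auto simp: preg_def)
  from pmult3_selfD[OF _ t] x have "lam S t = i" "rho S t = j"
      "(a \<bullet> x \<bullet> a) \<bullet> t \<bullet> a \<bullet> x \<bullet> a = a \<bullet> x \<bullet> a"
    by simp_all
  then show thesis
    using that[of t] t(1) x by (simp add: hom_iff)
qed

lemma P_closed:
  assumes "x \<in> scarrier P" "y \<in> scarrier P"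
  shows "sop P x y \<in> scarrier P"
proof -
  obtain z w where zw: "z \<in> hom_set S i j" "w \<in> hom_set S i j"
      "x \<bullet> a \<bullet> z \<bullet> a \<bullet> x = x" "y \<bullet> a \<bullet> w \<bullet> a \<bullet> y = y"
    using assms by (auto simp: P_iff)
  have xy: "x \<in> hom_set S i j" "y \<in> hom_set S i j"
    using assms P_hom by auto
  have "x \<bullet> a \<bullet> y \<in> hom_set S i j"
    using xy by (simp add: hom_iff)
  then obtain t where t: "t \<in> hom_set S i j"
      "a \<bullet> (x \<bullet> a \<bullet> y) \<bullet> a \<bullet> t \<bullet> a \<bullet> (x \<bullet> a \<bullet> y) \<bullet> a = a \<bullet> (x \<bullet> a \<bullet> y) \<bullet> a"
    using axa_regular by blast
  \<comment> \<open>Expanding the outer \<open>x\<close> and \<open>y\<close> by their own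
    regularity flanks the word with \<open>a\<close>, so that regularity of \<open>a(xay)a\<close>
    applies in the middle.\<close>
  have "(x \<bullet> a \<bullet> y) \<bullet> a \<bullet> t \<bullet> a \<bullet> (x \<bullet> a \<bullet> y)
      = (x \<bullet> a \<bullet> z \<bullet> a \<bullet> x) \<bullet> a \<bullet> y \<bullet> a \<bullet> t \<bullet> a \<bullet> x \<bullet> a \<bullet> (y \<bullet> a \<bullet> w \<bullet> a \<bullet> y)"
    using xy zw t(1) by (simp add: hom_iff)
  also have "\<dots> = (x \<bullet> a \<bullet> z) \<bullet>
      (a \<bullet> (x \<bullet> a \<bullet> y) \<bullet> a \<bullet> t \<bullet> a \<bullet> (x \<bullet> a \<bullet> y) \<bullet> a) \<bullet> w \<bullet> a \<bullet> y"
    using xy zw(1,2) t(1) by (simp add: hom_iff)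
  also have "\<dots> = (x \<bullet> a \<bullet> z \<bullet> a \<bullet> x) \<bullet> a \<bullet> (y \<bullet> a \<bullet> w \<bullet> a \<bullet> y)"
    unfolding t(2) using xy zw(1,2) by (simp add: hom_iff)
  also have "\<dots> = x \<bullet> a \<bullet> y"
    using zw by simp
  finally show ?thesis
    using xy t(1) \<open>x \<bullet> a \<bullet> y \<in> hom_set S i j\<close> by (auto simp: P_iff P_op)
qed

text \<open>Since \<open>aba = a\<close>, the element \<open>t\<close> that witnesses regularity of
  \<open>axa\<close> also does so for \<open>baxab\<close>. These elements are the images of
  \<open>W\<close> under \<psi>.\<close>

lemma baxab_in_P:
  assumes "x \<in> hom_set S i j"
  shows "b \<bullet> a \<bullet> x \<bullet> a \<bullet> b \<in> scarrier P"
proof -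
  obtain t where t: "t \<in> hom_set S i j" "a \<bullet> x \<bullet> a \<bullet> t \<bullet> a \<bullet> x \<bullet> a = a \<bullet> x \<bullet> a"
    using axa_regular assms by blast
  have "(b \<bullet> a \<bullet> x \<bullet> a \<bullet> b) \<bullet> a \<bullet> t \<bullet> a \<bullet> (b \<bullet> a \<bullet> x \<bullet> a \<bullet> b)
      = b \<bullet> (a \<bullet> x \<bullet> a \<bullet> t \<bullet> a \<bullet> x \<bullet> a) \<bullet> b"
    using assms t(1) by (simp add: hom_iff)
  also have "\<dots> = b \<bullet> a \<bullet> x \<bullet> a \<bullet> b"
    unfolding t(2) using assms by (simp add: hom_iff)
  finally show ?thesis
    unfolding P_iff using t(1) assms by (intro conjI bexI[of _ t]) (simp_all add: hom_iff)
qed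

lemma b_in_P: "b \<in> scarrier P"
  using baxab_in_P[of b] bab by (simp add: hom_iff)

lemma P_inverse:
  assumes "x \<in> scarrier P"
  obtains z where "z \<in> scarrier P" "x = sop P x (sop P z x)"
proof -
  obtain y where y: "y \<in> hom_set S i j" "x \<bullet> a \<bullet> y \<bullet> a \<bullet> x = x" and x: "x \<in> hom_set S i j"
    using assms by (auto simp: P_iff)
  have xy: "x \<bullet> a \<bullet> y \<bullet> a \<bullet> x \<bullet> a \<bullet> v = x \<bullet> a \<bullet> v" if "v \<in> hom_set S i j" for v
  proof -
    have "(x \<bullet> a \<bullet> y \<bullet> a \<bullet> x) \<bullet> a \<bullet> v = x \<bullet> a \<bullet> y \<bullet> a \<bullet> x \<bullet> a \<bullet> v"
      using x y(1) that by (simp add: hom_iff)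
    then show ?thesis
      by (simp add: y(2))
  qed
  \<comment> \<open>\<open>y\<close> need not be regular itself. The element \<open>yaxay\<close> is
    an inverse of \<open>x\<close> in both directions, so \<open>x\<close> witnesses that it lies in
    \<open>P\<close>.\<close>
  let ?z = "y \<bullet> a \<bullet> x \<bullet> a \<bullet> y"
  have z: "?z \<in> hom_set S i j"
    using x y by (simp add: hom_iff)
  have "x \<bullet> a \<bullet> ?z \<bullet> a \<bullet> x = x \<bullet> a \<bullet> y \<bullet> a \<bullet> x \<bullet> a \<bullet> y \<bullet> a \<bullet> x"
    using x y(1) by (simp add: hom_iff)
  also have "\<dots> = x"
    using xy[of "y \<bullet> a \<bullet> x"] x y by (simp add: hom_iff)
  finally have xzx: "x \<bullet> a \<bullet> ?z \<bullet> a \<bullet> x = x" .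
  have "?z \<bullet> a \<bullet> x \<bullet> a \<bullet> ?z = y \<bullet> a \<bullet> x \<bullet> a \<bullet> y \<bullet> a \<bullet> x \<bullet> a \<bullet> y \<bullet> a \<bullet> x \<bullet> a \<bullet> y"
    using x y(1) by (simp add: hom_iff)
  also have "\<dots> = ?z"
    using xy[of y] xy[of "y \<bullet> a \<bullet> x \<bullet> a \<bullet> y"] x y(1) by (simp add: hom_iff)
  finally have "?z \<in> scarrier P"
    using x z by (auto simp: P_iff)
  moreover have "x = sop P x (sop P ?z x)"
    using xzx x z by (simp add: P_op hom_iff)
  ultimately show thesis
    using that by blast
qed

text \<open>\<open>b\<close> is a mid-identity because \<open>xabay = xay\<close>, and \<phi> is
  multiplicative because \<open>axaya = (axa)b(aya)\<close>; both come from
  \<open>aba = a\<close>.\<close>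

sublocale mid_identity_retract P W b "\<lambda>x. prod3 S a x a" "\<lambda>w. prod3 S b w b"
proof
  show "sop P x y \<in> scarrier P" if "x \<in> scarrier P" "y \<in> scarrier P" for x y
    using that by (rule P_closed)
  show "sop P (sop P x y) z = sop P x (sop P y z)"
    if "x \<in> scarrier P" "y \<in> scarrier P" "z \<in> scarrier P" for x y z
    unfolding P_op using that P_hom by (intro T_assoc) auto
  show "\<exists>y \<in> scarrier P. x = sop P x (sop P y x)" if "x \<in> scarrier P" for x
    using that P_inverse by blast
  show "mid_identity P b"
    unfolding mid_identity_def P_op using b_in_P
    by (auto dest!: P_hom simp: hom_iff)
  show "prod3 S a x a \<in> scarrier W" if "x \<in> scarrier P" for x
    using that P_hom by (auto simp: W_sg_def)
  show "prod3 S b w b \<in> scarrier P" if "w \<in> scarrier W" for w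
    using that baxab_in_P by (auto simp: W_sg_def prod3_eq hom_iff)
  show "prod3 S a (sop P x y) a = sop W (prod3 S a x a) (prod3 S a y a)"
    if "x \<in> scarrier P" "y \<in> scarrier P" for x y
    using that[THEN P_hom] by (simp add: P_op W_sg_def prod3_eq hom_iff)
  show "prod3 S a (prod3 S b w b) a = w" if "w \<in> scarrier W" for w
    using that by (auto simp: W_sg_def prod3_eq hom_iff aba)
  show "prod3 S b (prod3 S a x a) b = sop P b (sop P x b)" if "x \<in> scarrier P" for x
    using that[THEN P_hom] by (simp add: P_op prod3_eq hom_iff)
qed

section \<open>Identification of \<open>r\<close> and \<open>l\<close> with the numbers of rows and
  columns\<close>

lemma H_hat_eq: "H_hat S i j a b = hat"
  by (simp add: H_hat_def hat_def)

lemma P_regular_in_T: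
  "scarrier P \<subseteq> scarrier T" "\<And>x. x \<in> scarrier P \<Longrightarrow> \<exists>y \<in> scarrier P. x = sop P x (sop P y x)"
  using P_hom P_inverse by auto blast

lemma hat_P: "hat \<subseteq> scarrier P"
  by (auto simp: hat_def)

lemma quotient_R_H_hat:
  "|H_hat S i j a b // Restr (green_R T) (H_hat S i j a b)| =o |rows|"
proof -
  have "Restr (green_R T) hat = Restr (green_R P) hat"
    by (rule Restr_green_R_regular) (use T_closed T_assoc P_op P_closed P_regular_in_T hat_P in auto)
  then show ?thesis
    using quotient_green_R_hat by (simp add: H_hat_eq)
qed

lemma quotient_L_H_hat:
  "|H_hat S i j a b // Restr (green_L T) (H_hat S i j a b)| =o |cols|"
proof -
  have "Restr (green_L T) hat = Restr (green_L P) hat"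
    by (rule Restr_green_L_regular) (use T_closed T_assoc P_op P_closed P_regular_in_T hat_P in auto)
  then show ?thesis
    using quotient_green_L_hat by (simp add: H_hat_eq)
qed

end

theorem theorem3p17:
  fixes S :: "('s, 'i) partial_sg" and i j :: 'i and a b :: 's
  assumes "partial_semigroup S"
    and "i \<in> objs S" and "j \<in> objs S"
    and "a \<in> hom_set S j i" and "sandwich_regular S i j a"
    and "b \<in> pinverses S a"
  shows "let P = P_sg S i j a; W = W_sg S i j a b; H = H_hat S i j a b;
             r = |H // Restr (green_R (sandwich_sg S i j a)) H|;
             l = |H // Restr (green_L (sandwich_sg S i j a)) H|
         in cpred (sg_rank (idem_gen W) +c cmax r l) \<le>o sg_rank (idem_gen P)
          \<and> cpred (sg_idrank (idem_gen W) +c cmax r l) \<le>o sg_idrank (idem_gen P)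
          \<and> (MI_dominated P \<longrightarrow>
               sg_rank (idem_gen P) =o cpred (sg_rank (idem_gen W) +c cmax r l)
             \<and> sg_idrank (idem_gen P) =o cpred (sg_idrank (idem_gen W) +c cmax r l))"
proof -
  interpret sandwich S i j a b
    using assms by (simp add: sandwich_def sandwich_axioms_def)
  note rank = rank_idem_gen[OF quotient_R_H_hat quotient_L_H_hat]
    and idrank = idrank_idem_gen[OF quotient_R_H_hat quotient_L_H_hat]
  show ?thesis
    unfolding Let_def using rank idrank by blast
qed

end
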